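(* Let $k \geq 2$ and $t > (2k)^k$. If $\mathcal{H}$ is a $k$-uniform hypergraph, then Breaker has a winning strategy in $\mathbf{G}(\mathcal{H};q)$ provided that $$q > 4\max\left( \left( (2v(\mathcal{H}))^{1/t}\,\Delta_1(\mathcal{H})\, k e\right)^{\frac{1}{k-1}},\; 2k^2t^3\left( \max_{2\leq\ell\leq k-1}\left( \Delta_\ell(\mathcal{H})\left((tk)^{tk} k^t v(\mathcal{H})^2\right)^{\frac{k}{t^{1/k}}}\right)^{\frac{1}{k-\ell}} + 2\right)\right).$$
   Context: $e$ denotes the base of the natural logarithm. For a hypergraph $\mathcal{H}$, $v(\mathcal{H})$ is its number of vertices; $\deg(S)$ is the number of edges containing $S\subseteq V(\mathcal{H})$ and $\Delta_\ell(\mathcal{H}) = \max\{\deg(S) : |S| = \ell\}$. $\mathbf{G}(\mathcal{H};q)$ is the $q$-biased Maker-Breaker game: Maker and Breaker alternately occupy previously unoccupied vertices, Maker first, Maker one vertex per round and Breaker up to $q$; Maker wins iff he fully occupies an edge of $\mathcal{H}$, Breaker wins otherwise. *)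

theory Defs
  imports Complex_Main
begin

definition uniform_hypergraph :: "'a set \<Rightarrow> 'a set set \<Rightarrow> nat \<Rightarrow> bool" where
  "uniform_hypergraph V E k \<longleftrightarrow> finite V \<and> (\<forall>e\<in>E. e \<subseteq> V \<and> card e = k)"

definition hdeg :: "'a set set \<Rightarrow> 'a set \<Rightarrow> nat" where
  "hdeg E S = card {e \<in> E. S \<subseteq> e}"

text \<open>The inserted 0 only matters when there is no \<open>l\<close>-subset of \<open>V\<close>.\<close>

definition max_hdeg :: "'a set \<Rightarrow> 'a set set \<Rightarrow> nat \<Rightarrow> nat" where
  "max_hdeg V E l = Max (insert 0 (hdeg E ` {S. S \<subseteq> V \<and> card S = l}))"

text \<open>A history lists the completed rounds in chronological order; the entry \<open>(x, B)\<close> records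
  that Maker took \<open>x\<close> and Breaker answered with the set \<open>B\<close>. A strategy of Breaker maps the
  history and Maker's current move to Breaker's answer.\<close>

type_synonym 'a history = "('a \<times> 'a set) list"
type_synonym 'a breaker_strategy = "'a history \<Rightarrow> 'a \<Rightarrow> 'a set"

definition maker_set :: "'a history \<Rightarrow> 'a set" where
  "maker_set h = fst ` set h"

definition breaker_set :: "'a history \<Rightarrow> 'a set" where
  "breaker_set h = \<Union> (snd ` set h)"

definition free_set :: "'a set \<Rightarrow> 'a history \<Rightarrow> 'a set" where
  "free_set V h = V - maker_set h - breaker_set h"

inductive play :: "'a set \<Rightarrow> 'a breaker_strategy \<Rightarrow> 'a history \<Rightarrow> bool" for V \<sigma> where
  start: "play V \<sigma> []"
| round: "play V \<sigma> h \<Longrightarrow> x \<in> free_set V h \<Longrightarrow> play V \<sigma> (h @ [(x, \<sigma> h x)])"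

definition legal_breaker_strategy :: "'a set \<Rightarrow> nat \<Rightarrow> 'a breaker_strategy \<Rightarrow> bool" where
  "legal_breaker_strategy V q \<sigma> \<longleftrightarrow>
     (\<forall>h x. play V \<sigma> h \<longrightarrow> x \<in> free_set V h \<longrightarrow>
        \<sigma> h x \<subseteq> free_set V h - {x} \<and> card (\<sigma> h x) \<le> q)"

text \<open>Quantifying over all plays, not just those that exhaust the board, is harmless:
  Maker's set only grows and \<open>V\<close> is finite.\<close>

definition breaker_wins :: "'a set \<Rightarrow> 'a set set \<Rightarrow> nat \<Rightarrow> bool" where
  "breaker_wins V E q \<longleftrightarrow>
     (\<exists>\<sigma>. legal_breaker_strategy V q \<sigma> \<and>
          (\<forall>h. play V \<sigma> h \<longrightarrow> \<not> (\<exists>e\<in>E. e \<subseteq> maker_set h)))"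

end

(*
  Breaker splits his bias. With half of it he immediately occupies every vertex that would complete
  an edge; it remains to see that a single move of Maker never creates more than q/2 such threats.
  With the other half he plays the biased Erdos-Selfridge strategy, which bounds the weighted number
  of flowers occupied by Maker: a flower consists of a core S and a sequence of edges through S,
  each with one open vertex, whose remaining parts outside S are pairwise disjoint.

  If many threats pass through S but few through each S + z, then most sequences of these threats
  have disjoint petals, so that Maker would occupy too many flowers. Going down from |S| = k
  to |S| = 1 this bounds the number N_l of threats through a core of size l recursively by
  N_l = p_l k N_(l+1) + g_l, where p_l is the number of petals and g_l^(p_l) bounds the number of
  occupied flowers with that core. The two terms of the maximum in the hypothesis are what is needed
  for l = 1, with about t petals, and for l >= 2, with about t^(1/k) / 2 petals.
*)
theory Submission
  imports Defs
begin

section \<open>Potential strategies\<close>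

lemma breaker_wins_by_invariant:
  assumes initial: "Inv {} {}"
    and reply: "\<And>M B x. Inv M B \<Longrightarrow> x \<in> V - M - B \<Longrightarrow>
      \<exists>Y\<subseteq>V - insert x M - B. card Y \<le> q \<and> Inv (insert x M) (B \<union> Y)"
    and no_edge: "\<And>M B e. Inv M B \<Longrightarrow> e \<in> E \<Longrightarrow> \<not> e \<subseteq> M"
  shows "breaker_wins V E q"
proof -
  define good where "good M B x Y \<longleftrightarrow>
    Y \<subseteq> V - insert x M - B \<and> card Y \<le> q \<and> Inv (insert x M) (B \<union> Y)" for M B x Y
  define \<sigma> where "\<sigma> h x = (SOME Y. good (maker_set h) (breaker_set h) x Y)" for h x
  have good: "good (maker_set h) (breaker_set h) x (\<sigma> h x)"
    if "Inv (maker_set h) (breaker_set h)" "x \<in> free_set V h" for h x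
  proof -
    have "\<exists>Y. good (maker_set h) (breaker_set h) x Y"
      using reply[OF that(1)] that(2) by (auto simp: good_def free_set_def)
    then show ?thesis unfolding \<sigma>_def by (rule someI_ex)
  qed
  have inv: "Inv (maker_set h) (breaker_set h)" if "play V \<sigma> h" for h
    using that
  proof induction
    case start
    show ?case using initial by (simp add: maker_set_def breaker_set_def)
  next
    case (round h x)
    have "maker_set (h @ [(x, \<sigma> h x)]) = insert x (maker_set h)"
      and "breaker_set (h @ [(x, \<sigma> h x)]) = breaker_set h \<union> \<sigma> h x"
      by (auto simp: maker_set_def breaker_set_def)
    then show ?case using good[OF round.IH round.hyps(2)] by (simp add: good_def)
  qed
  have "\<sigma> h x \<subseteq> free_set V h - {x} \<and> card (\<sigma> h x) \<le> q"
    if "play V \<sigma> h" "x \<in> free_set V h" for h x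
    using good[OF inv[OF that(1)] that(2)] unfolding good_def free_set_def by blast
  then have "legal_breaker_strategy V q \<sigma>" by (simp add: legal_breaker_strategy_def)
  then show ?thesis unfolding breaker_wins_def using no_edge[OF inv] by blast
qed

definition threats :: "'a set set \<Rightarrow> 'a set \<Rightarrow> 'a set \<Rightarrow> 'a set" where
  "threats E M S = {y. \<exists>e\<in>E. S \<subseteq> e \<and> e - M = {y}}"

definition all_threats_blocked :: "'a set set \<Rightarrow> 'a set \<Rightarrow> 'a set \<Rightarrow> bool" where
  "all_threats_blocked E M B \<longleftrightarrow> (\<forall>e\<in>E. e \<inter> B = {} \<longrightarrow> (\<forall>y. \<not> e \<subseteq> insert y M))"

lemma all_threats_blocked_initial:
  assumes "\<And>e. e \<in> E \<Longrightarrow> 2 \<le> card e"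
  shows "all_threats_blocked E {} {}"
proof -
  have "\<not> e \<subseteq> {y}" if "e \<in> E" for e y
    using assms[OF that] card_mono[of "{y}" e] by auto
  then show ?thesis by (simp add: all_threats_blocked_def)
qed

lemma all_threats_blocked_reply:
  assumes blocked: "all_threats_blocked E M B" and reply: "threats E (insert x M) {x} - B \<subseteq> Y"
  shows "all_threats_blocked E (insert x M) (B \<union> Y)"
proof -
  have "\<not> e \<subseteq> insert y (insert x M)" if e: "e \<in> E" "e \<inter> (B \<union> Y) = {}" for e y
  proof
    assume sub: "e \<subseteq> insert y (insert x M)"
    have old: "\<not> e \<subseteq> insert z M" for z
      using blocked e by (auto simp: all_threats_blocked_def)
    have "x \<in> e" "e - insert x M = {y}" using old[of x] old[of y] sub by auto
    then have "y \<in> threats E (insert x M) {x}" using e(1) by (auto simp: threats_def)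
    then show False using reply e(2) \<open>e - insert x M = {y}\<close> by blast
  qed
  then show ?thesis by (simp add: all_threats_blocked_def)
qed

lemma not_subset_if_all_threats_blocked:
  assumes "all_threats_blocked E M B" "M \<inter> B = {}" "e \<in> E"
  shows "\<not> e \<subseteq> M"
proof
  assume "e \<subseteq> M"
  then have "e \<inter> B = {}" "\<And>y. e \<subseteq> insert y M" using assms(2) by auto
  then show False using assms(1,3) by (simp add: all_threats_blocked_def)
qed

locale weighted_family =
  fixes I :: "'i set" and A :: "'i \<Rightarrow> 'a set" and w :: "'i \<Rightarrow> real" and b :: nat
  assumes finite_index: "finite I"
    and finite_member: "i \<in> I \<Longrightarrow> finite (A i)"
    and weight_nonneg: "i \<in> I \<Longrightarrow> 0 \<le> w i"
begin

definition potential :: "'a set \<Rightarrow> 'a set \<Rightarrow> real" where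
  "potential M B = (\<Sum>i | i \<in> I \<and> A i \<inter> B = {}. w i / (1 + real b) ^ card (A i - M))"

definition danger :: "'a set \<Rightarrow> 'a set \<Rightarrow> 'a \<Rightarrow> real" where
  "danger M B x = (\<Sum>i | i \<in> I \<and> A i \<inter> B = {} \<and> x \<in> A i. w i / (1 + real b) ^ card (A i - M))"

definition occupied_weight :: "'a set \<Rightarrow> real" where
  "occupied_weight M = (\<Sum>i | i \<in> I \<and> A i \<subseteq> M. w i)"

lemma potential_antimono: "B \<subseteq> B' \<Longrightarrow> potential M B' \<le> potential M B"
  unfolding potential_def using finite_index weight_nonneg by (intro sum_mono2) auto

lemma danger_antimono: "B \<subseteq> B' \<Longrightarrow> danger M B' x \<le> danger M B x"
  unfolding danger_def using finite_index weight_nonneg by (intro sum_mono2) auto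

lemma danger_le_potential: "danger M B x \<le> potential M B"
  unfolding danger_def potential_def using finite_index weight_nonneg by (intro sum_mono2) auto

lemma potential_insert_breaker: "potential M (insert y B) = potential M B - danger M B y"
proof -
  have split: "{i \<in> I. A i \<inter> B = {}} =
      {i \<in> I. A i \<inter> insert y B = {}} \<union> {i \<in> I. A i \<inter> B = {} \<and> y \<in> A i}" by auto
  have "potential M B = potential M (insert y B) + danger M B y"
    unfolding potential_def danger_def split using finite_index by (intro sum.union_disjoint) auto
  then show ?thesis by simp
qed

lemma potential_insert_maker:
  assumes "x \<notin> M"
  shows "potential (insert x M) B = potential M B + real b * danger M B x"
proof -
  let ?J = "{i \<in> I. A i \<inter> B = {}}" and ?u = "\<lambda>i. w i / (1 + real b) ^ card (A i - M)"
  have "w i / (1 + real b) ^ card (A i - insert x M) =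
      ?u i + (if x \<in> A i then real b * ?u i else 0)"
    if "i \<in> I" for i
  proof (cases "x \<in> A i")
    case True
    have "card (A i - M) = Suc (card (A i - insert x M))"
      using card_Suc_Diff1[of "A i - M" x] finite_member[OF that] assms True
      by (simp add: Diff_insert[symmetric])
    then show ?thesis using True by (simp add: divide_simps) (simp add: algebra_simps)
  qed simp
  then have "potential (insert x M) B = (\<Sum>i\<in>?J. ?u i + (if x \<in> A i then real b * ?u i else 0))"
    unfolding potential_def by (intro sum.cong) auto
  also have "\<dots> = potential M B + (\<Sum>i\<in>{i \<in> ?J. x \<in> A i}. real b * ?u i)"
    unfolding potential_def sum.distrib using finite_index by (subst (2) sum.inter_filter) auto
  also have "{i \<in> ?J. x \<in> A i} = {i \<in> I. A i \<inter> B = {} \<and> x \<in> A i}" by auto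
  finally show ?thesis unfolding danger_def by (simp add: sum_distrib_left)
qed

lemma potential_insert_maker_le:
  assumes "x \<notin> M"
  shows "potential (insert x M) B \<le> (1 + real b) * potential M B"
  using mult_left_mono[OF danger_le_potential[of M B x], of "real b"]
  by (simp add: potential_insert_maker[OF assms] algebra_simps)

lemma occupied_weight_le_potential:
  assumes "M \<inter> B = {}"
  shows "occupied_weight M \<le> potential M B"
proof -
  have "w i = w i / (1 + real b) ^ card (A i - M)" if "A i \<subseteq> M" for i
  proof -
    have "A i - M = {}" using that by blast
    then show ?thesis by (simp only: card.empty power_0 div_by_1)
  qed
  then have "occupied_weight M = (\<Sum>i | i \<in> I \<and> A i \<subseteq> M. w i / (1 + real b) ^ card (A i - M))"
    unfolding occupied_weight_def by (intro sum.cong) auto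
  also have "\<dots> \<le> potential M B"
    unfolding potential_def using finite_index weight_nonneg assms by (intro sum_mono2) auto
  finally show ?thesis .
qed

lemma exists_most_dangerous:
  assumes "finite F" "F \<noteq> {}"
  shows "\<exists>y\<in>F. \<forall>x\<in>F. danger M B x \<le> danger M B y"
  using ex_is_arg_min_if_finite[OF assms, of "\<lambda>x. - danger M B x"]
  by (auto simp: is_arg_min_linorder)

text \<open>Each vertex of \<open>Y\<close> is chosen with maximal danger, and its danger is the resulting decrease of
  the potential.\<close>

lemma exists_set_reducing_danger:
  assumes "finite F"
  shows "\<exists>Y\<subseteq>F. card Y \<le> n \<and>
    (\<forall>x\<in>F - Y. real n * danger M (B \<union> Y) x \<le> potential M B - potential M (B \<union> Y))"
proof (induction n)
  case 0
  show ?case by (intro exI[of _ "{}"]) auto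
next
  case (Suc n)
  then obtain Y where Y: "Y \<subseteq> F" "card Y \<le> n"
    and IH: "\<And>x. x \<in> F - Y \<Longrightarrow>
      real n * danger M (B \<union> Y) x \<le> potential M B - potential M (B \<union> Y)"
    by blast
  show ?case
  proof (cases "F - Y = {}")
    case True
    then show ?thesis using Y by (intro exI[of _ Y]) auto
  next
    case False
    then obtain y where y: "y \<in> F - Y"
      and most: "\<And>x. x \<in> F - Y \<Longrightarrow> danger M (B \<union> Y) x \<le> danger M (B \<union> Y) y"
      using exists_most_dangerous[of "F - Y" M "B \<union> Y"] assms by auto
    have "real (Suc n) * danger M (B \<union> insert y Y) x \<le>
        potential M B - potential M (B \<union> insert y Y)" if x: "x \<in> F - insert y Y" for x
    proof -
      have "real (Suc n) * danger M (B \<union> insert y Y) x \<le> real (Suc n) * danger M (B \<union> Y) x"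
        by (intro mult_left_mono danger_antimono) auto
      also have "\<dots> = real n * danger M (B \<union> Y) x + danger M (B \<union> Y) x"
        by (simp add: algebra_simps)
      also have "\<dots> \<le> potential M B - potential M (B \<union> Y) + danger M (B \<union> Y) y"
        using x by (intro add_mono IH most) auto
      also have "\<dots> = potential M B - potential M (B \<union> insert y Y)"
        by (simp add: potential_insert_breaker)
      finally show ?thesis .
    qed
    moreover have "card (insert y Y) \<le> Suc n"
      using Y finite_subset[OF Y(1) assms] by (simp add: card_insert_if)
    ultimately show ?thesis using Y(1) y by (intro exI[of _ "insert y Y"]) auto
  qed
qed

lemma exists_greedy_reply:
  assumes "finite F" "F \<inter> M = {}"
  shows "\<exists>Y\<subseteq>F. card Y \<le> b \<and> (\<forall>x\<in>F - Y. potential (insert x M) (B \<union> Y) \<le> potential M B)"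
proof -
  obtain Y where Y: "Y \<subseteq> F" "card Y \<le> b" and reduced: "\<And>x. x \<in> F - Y \<Longrightarrow>
      real b * danger M (B \<union> Y) x \<le> potential M B - potential M (B \<union> Y)"
    using exists_set_reducing_danger[OF assms(1), of b M B] by blast
  have "potential (insert x M) (B \<union> Y) \<le> potential M B" if "x \<in> F - Y" for x
  proof -
    have "x \<notin> M" using that assms(2) by blast
    then show ?thesis using reduced[OF that] by (simp add: potential_insert_maker)
  qed
  then show ?thesis using Y by blast
qed

definition under_control :: "'a set \<Rightarrow> 'a set set \<Rightarrow> 'a set \<Rightarrow> 'a set \<Rightarrow> bool" where
  "under_control V E M B \<longleftrightarrow> M \<subseteq> V \<and> M \<inter> B = {} \<and> all_threats_blocked E M B \<and>
    (\<forall>x\<in>V - M - B. potential (insert x M) B \<le> 1)"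

lemma under_control_initial:
  assumes "\<And>e. e \<in> E \<Longrightarrow> 2 \<le> card e" and "potential {} {} \<le> 1 / (1 + real b)"
  shows "under_control V E {} {}"
proof -
  have "potential {x} {} \<le> 1" for x
  proof -
    have "potential {x} {} \<le> (1 + real b) * potential {} {}"
      by (rule potential_insert_maker_le) simp
    also have "\<dots> \<le> 1" using assms(2) by (simp add: field_simps)
    finally show ?thesis .
  qed
  then show ?thesis
    using all_threats_blocked_initial[OF assms(1)] by (simp add: under_control_def)
qed

lemma under_control_reply:
  assumes V: "finite V" "\<Union> E \<subseteq> V" and control: "under_control V E M B" and x: "x \<in> V - M - B"
    and few: "card (threats E (insert x M) {x}) + b \<le> q"
  shows "\<exists>Y\<subseteq>V - insert x M - B. card Y \<le> q \<and> under_control V E (insert x M) (B \<union> Y)"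
proof -
  define T where "T = threats E (insert x M) {x} - B"
  have T_free: "T \<subseteq> V - insert x M - B" using V(2) by (auto simp: T_def threats_def)
  obtain Y where Y: "Y \<subseteq> V - insert x M - B - T" "card Y \<le> b"
    and greedy: "\<And>z. z \<in> V - insert x M - B - T - Y \<Longrightarrow>
      potential (insert z (insert x M)) (B \<union> T \<union> Y) \<le> potential (insert x M) (B \<union> T)"
    using exists_greedy_reply[of "V - insert x M - B - T" "insert x M" "B \<union> T"] V(1) by blast
  have reply_free: "T \<union> Y \<subseteq> V - insert x M - B" using T_free Y(1) by auto
  have "threats E (insert x M) {x} \<subseteq> V" using V(2) by (auto simp: threats_def)
  then have "card T \<le> card (threats E (insert x M) {x})"
    unfolding T_def using finite_subset[OF _ V(1)] by (intro card_mono) auto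
  then have card_reply: "card (T \<union> Y) \<le> q" using card_Un_le[of T Y] Y(2) few by linarith
  have potential_reply: "potential (insert z (insert x M)) (B \<union> (T \<union> Y)) \<le> 1"
    if "z \<in> V - insert x M - (B \<union> (T \<union> Y))" for z
  proof -
    have "potential (insert z (insert x M)) (B \<union> (T \<union> Y)) \<le> potential (insert x M) (B \<union> T)"
      using greedy[of z] that by (simp add: Un_assoc)
    also have "\<dots> \<le> potential (insert x M) B" by (rule potential_antimono) simp
    also have "\<dots> \<le> 1" using control x by (simp add: under_control_def)
    finally show ?thesis .
  qed
  have "under_control V E (insert x M) (B \<union> (T \<union> Y))"
    unfolding under_control_def
  proof (intro conjI ballI)
    show "insert x M \<subseteq> V" "insert x M \<inter> (B \<union> (T \<union> Y)) = {}"
      using control x reply_free by (auto simp: under_control_def)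
    show "all_threats_blocked E (insert x M) (B \<union> (T \<union> Y))"
      using control by (intro all_threats_blocked_reply) (auto simp: under_control_def T_def)
  qed (rule potential_reply)
  then show ?thesis using card_reply reply_free by blast
qed

lemma breaker_wins_by_potential:
  assumes V: "finite V" "\<Union> E \<subseteq> V" and edges: "\<And>e. e \<in> E \<Longrightarrow> 2 \<le> card e"
    and initial: "potential {} {} \<le> 1 / (1 + real b)"
    and few: "\<And>M x. M \<subseteq> V \<Longrightarrow> x \<in> M \<Longrightarrow> occupied_weight M \<le> 1 \<Longrightarrow>
      card (threats E M {x}) + b \<le> q"
  shows "breaker_wins V E q"
proof (rule breaker_wins_by_invariant[where Inv = "under_control V E"])
  show "under_control V E {} {}" using edges initial by (rule under_control_initial)
next
  fix M B x assume control: "under_control V E M B" and x: "x \<in> V - M - B"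
  have "occupied_weight (insert x M) \<le> potential (insert x M) B"
    using control x by (intro occupied_weight_le_potential) (auto simp: under_control_def)
  also have "\<dots> \<le> 1" using control x by (simp add: under_control_def)
  finally have "card (threats E (insert x M) {x}) + b \<le> q"
    using control x by (intro few) (auto simp: under_control_def)
  then show "\<exists>Y\<subseteq>V - insert x M - B. card Y \<le> q \<and> under_control V E (insert x M) (B \<union> Y)"
    by (rule under_control_reply[OF V control x])
next
  fix M B e assume "under_control V E M B" "e \<in> E"
  then show "\<not> e \<subseteq> M"
    unfolding under_control_def by (intro not_subset_if_all_threats_blocked) auto
qed

end

section \<open>Counting pairwise compatible sequences\<close>

definition compatible_lists :: "('b \<Rightarrow> 'b \<Rightarrow> bool) \<Rightarrow> 'b set \<Rightarrow> nat \<Rightarrow> 'b list set" where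
  "compatible_lists R W n = {L. set L \<subseteq> W \<and> length L = n \<and> sorted_wrt R L}"

lemma compatible_lists_0: "compatible_lists R W 0 = {[]}"
  by (auto simp: compatible_lists_def)

lemma Cons_in_compatible_lists_iff:
  "a # L \<in> compatible_lists R W (Suc n) \<longleftrightarrow>
    a \<in> W \<and> (\<forall>b\<in>set L. R a b) \<and> L \<in> compatible_lists R W n"
  by (auto simp: compatible_lists_def)

lemma
  assumes "finite W"
  shows finite_compatible_lists: "finite (compatible_lists R W n)"
    and card_compatible_lists_le: "card (compatible_lists R W n) \<le> card W ^ n"
proof -
  let ?all = "{L. set L \<subseteq> W \<and> length L = n}"
  have sub: "compatible_lists R W n \<subseteq> ?all" by (auto simp: compatible_lists_def)
  have fin: "finite ?all" by (rule finite_lists_length_eq[OF assms])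
  show "finite (compatible_lists R W n)" using sub fin by (rule finite_subset)
  show "card (compatible_lists R W n) \<le> card W ^ n"
    using card_mono[OF fin sub] by (simp add: card_lists_length_eq[OF assms])
qed

lemma card_compatible_extensions_ge:
  fixes c :: real
  assumes W: "finite W" "set L \<subseteq> W" and c: "0 \<le> c"
    and conflicts: "\<And>b. b \<in> W \<Longrightarrow> real (card {a \<in> W. \<not> R a b}) \<le> c"
  shows "real (card W) \<le> real (card {a \<in> W. \<forall>b\<in>set L. R a b}) + real (length L) * c"
proof -
  let ?N = "{a \<in> W. \<forall>b\<in>set L. R a b}" and ?C = "\<Union>b\<in>set L. {a \<in> W. \<not> R a b}"
  have "card W \<le> card (?N \<union> ?C)" using W by (intro card_mono) auto
  then have "card W \<le> card ?N + card ?C" using card_Un_le[of ?N ?C] by linarith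
  moreover have "real (card ?C) \<le> real (length L) * c"
  proof -
    have "real (card ?C) \<le> (\<Sum>b\<in>set L. real (card {a \<in> W. \<not> R a b}))"
      unfolding of_nat_sum[symmetric] of_nat_le_iff by (intro card_UN_le) simp
    also have "\<dots> \<le> (\<Sum>b\<in>set L. c)" using W conflicts by (intro sum_mono) auto
    also have "\<dots> \<le> real (length L) * c"
      using card_length[of L] c by (simp add: mult_right_mono)
    finally show ?thesis .
  qed
  ultimately show ?thesis by linarith
qed

lemma card_compatible_lists_ge:
  fixes c d :: real
  assumes W: "finite W" and conflicts: "\<And>b. b \<in> W \<Longrightarrow> real (card {a \<in> W. \<not> R a b}) \<le> c"
    and c: "0 \<le> c" and d: "0 \<le> d" and "real n * c + d \<le> real (card W)"
  shows "d ^ n \<le> real (card (compatible_lists R W n))"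
  using assms(5)
proof (induction n)
  case 0
  then show ?case by (simp add: compatible_lists_0)
next
  case (Suc n)
  let ?N = "\<lambda>L. {a \<in> W. \<forall>b\<in>set L. R a b}" and ?S = "compatible_lists R W n"
  have room: "real n * c + d \<le> real (card W)" using Suc.prems c by (simp add: algebra_simps)
  have extensions: "d \<le> real (card (?N L))" if "L \<in> ?S" for L
  proof -
    have "set L \<subseteq> W" "length L = n" using that by (auto simp: compatible_lists_def)
    then show ?thesis
      using card_compatible_extensions_ge[of W L c R] W c conflicts room by auto
  qed
  have fin: "finite ?S" by (rule finite_compatible_lists[OF W])
  have "d ^ Suc n \<le> real (card ?S) * d"
    using mult_right_mono[OF Suc.IH[OF room] d] by (simp add: mult.commute)
  also have "\<dots> = (\<Sum>L\<in>?S. d)" by simp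
  also have "\<dots> \<le> (\<Sum>L\<in>?S. real (card (?N L)))" using extensions by (rule sum_mono)
  also have "\<dots> = real (card (Sigma ?S ?N))" using fin W by (simp add: card_SigmaI)
  also have "\<dots> = real (card ((\<lambda>(L, a). a # L) ` Sigma ?S ?N))"
    by (subst card_image) (auto simp: inj_on_def)
  also have "\<dots> \<le> real (card (compatible_lists R W (Suc n)))"
    using finite_compatible_lists[OF W]
    by (intro of_nat_mono card_mono) (auto simp: Cons_in_compatible_lists_iff)
  finally show ?case .
qed

lemma card_le_of_few_compatible_lists:
  fixes c g :: real
  assumes W: "finite W" and conflicts: "\<And>b. b \<in> W \<Longrightarrow> real (card {a \<in> W. \<not> R a b}) \<le> c"
    and c: "0 \<le> c" and g: "0 \<le> g" and n: "0 < n"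
    and few: "real (card (compatible_lists R W n)) \<le> g ^ n"
  shows "real (card W) \<le> real n * c + g"
proof (rule ccontr)
  assume many: "\<not> real (card W) \<le> real n * c + g"
  let ?d = "real (card W) - real n * c"
  have "?d ^ n \<le> real (card (compatible_lists R W n))"
    using many g by (intro card_compatible_lists_ge[OF W conflicts c]) auto
  also have "\<dots> \<le> g ^ n" by (rule few)
  finally have "?d \<le> g" using many g n by (simp add: power_mono_iff)
  then show False using many by simp
qed

section \<open>Threats and flowers\<close>

definition pointed_edges :: "'a set set \<Rightarrow> 'a set \<Rightarrow> ('a set \<times> 'a) set" where
  "pointed_edges E S = (SIGMA e:{e \<in> E. S \<subseteq> e}. e - S)"

definition petal :: "'a set \<Rightarrow> 'a set \<times> 'a \<Rightarrow> 'a set" where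
  "petal S a = fst a - insert (snd a) S"

abbreviation disjoint_petals :: "'a set \<Rightarrow> 'a set \<times> 'a \<Rightarrow> 'a set \<times> 'a \<Rightarrow> bool" where
  "disjoint_petals S a b \<equiv> petal S a \<inter> petal S b = {}"

text \<open>An entry \<open>(e, y)\<close> is an edge together with its open vertex. Repetitions are allowed; by the
  disjointness condition they can only occur if the petals are empty.\<close>

definition flowers :: "'a set set \<Rightarrow> 'a set \<Rightarrow> nat \<Rightarrow> ('a set \<times> 'a) list set" where
  "flowers E S p = compatible_lists (disjoint_petals S) (pointed_edges E S) p"

definition flower_set :: "'a set \<Rightarrow> ('a set \<times> 'a) list \<Rightarrow> 'a set" where
  "flower_set S L = S \<union> \<Union> (petal S ` set L)"

definition occupied_flowers ::
    "'a set set \<Rightarrow> 'a set \<Rightarrow> 'a set \<Rightarrow> nat \<Rightarrow> ('a set \<times> 'a) list set" where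
  "occupied_flowers E M S p = {L \<in> flowers E S p. flower_set S L \<subseteq> M}"

definition threatening_edges :: "'a set set \<Rightarrow> 'a set \<Rightarrow> 'a set \<Rightarrow> ('a set \<times> 'a) set" where
  "threatening_edges E M S = {(e, y) \<in> pointed_edges E S. e - M = {y}}"

lemma threats_eq_image:
  assumes "S \<subseteq> M"
  shows "threats E M S = snd ` threatening_edges E M S"
proof
  show "threats E M S \<subseteq> snd ` threatening_edges E M S"
  proof
    fix y assume "y \<in> threats E M S"
    then obtain e where "e \<in> E" "S \<subseteq> e" "e - M = {y}" by (auto simp: threats_def)
    moreover from this assms have "y \<in> e - S" by blast
    ultimately have "(e, y) \<in> threatening_edges E M S"
      by (simp add: threatening_edges_def pointed_edges_def)
    then show "y \<in> snd ` threatening_edges E M S" by force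
  qed
next
  have "y \<in> threats E M S" if "(e, y) \<in> threatening_edges E M S" for e y
    using that unfolding threats_def threatening_edges_def pointed_edges_def by blast
  then show "snd ` threatening_edges E M S \<subseteq> threats E M S" by auto
qed

lemma petal_threatening_edge_subset: "a \<in> threatening_edges E M S \<Longrightarrow> petal S a \<subseteq> M - S"
  by (auto simp: threatening_edges_def petal_def)

lemma threat_through_petal:
  assumes "(e, y) \<in> threatening_edges E M S" "z \<in> petal S (e, y)"
  shows "y \<in> threats E M (insert z S)"
  using assms by (auto simp: threats_def threatening_edges_def pointed_edges_def petal_def)

lemma compatible_threatening_edges_subset_occupied_flowers:
  assumes "S \<subseteq> M" "W \<subseteq> threatening_edges E M S"
  shows "compatible_lists (disjoint_petals S) W p \<subseteq> occupied_flowers E M S p"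
proof
  fix L assume "L \<in> compatible_lists (disjoint_petals S) W p"
  then have L: "set L \<subseteq> W" "length L = p" "sorted_wrt (disjoint_petals S) L"
    by (auto simp: compatible_lists_def)
  have "flower_set S L \<subseteq> M"
    using L(1) assms petal_threatening_edge_subset unfolding flower_set_def by blast
  moreover have "set L \<subseteq> pointed_edges E S"
    using L(1) assms(2) by (auto simp: threatening_edges_def)
  ultimately show "L \<in> occupied_flowers E M S p"
    using L by (simp add: occupied_flowers_def flowers_def compatible_lists_def)
qed

lemma hdeg_le_max_hdeg:
  assumes "finite V" "S \<subseteq> V"
  shows "hdeg E S \<le> max_hdeg V E (card S)"
  unfolding max_hdeg_def using assms by (intro Max_ge) auto

locale finite_uniform_hypergraph =
  fixes V :: "'a set" and E :: "'a set set" and k :: nat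
  assumes uniform: "uniform_hypergraph V E k"
begin

lemma finite_vertices: "finite V"
  using uniform by (simp add: uniform_hypergraph_def)

lemma edge_subset: "e \<in> E \<Longrightarrow> e \<subseteq> V"
  and card_edge: "e \<in> E \<Longrightarrow> card e = k"
  using uniform by (auto simp: uniform_hypergraph_def)

lemma finite_edge: "e \<in> E \<Longrightarrow> finite e"
  using edge_subset finite_vertices finite_subset by blast

lemma finite_edges: "finite E"
  using edge_subset finite_vertices by (intro finite_subset[of E "Pow V"]) auto

lemma finite_vertex_subset: "S \<subseteq> V \<Longrightarrow> finite S"
  using finite_vertices by (rule rev_finite_subset)

lemma finite_pointed_edges: "finite (pointed_edges E S)"
  unfolding pointed_edges_def using finite_edges finite_edge by auto

lemma card_pointed_edges_le:
  assumes "S \<subseteq> V"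
  shows "card (pointed_edges E S) \<le> max_hdeg V E (card S) * k"
proof -
  have "card (pointed_edges E S) = (\<Sum>e | e \<in> E \<and> S \<subseteq> e. card (e - S))"
    unfolding pointed_edges_def using finite_edges finite_edge by (intro card_SigmaI) auto
  also have "\<dots> \<le> (\<Sum>e | e \<in> E \<and> S \<subseteq> e. k)"
    using card_edge finite_edge card_mono[of _ "_ - S"] by (intro sum_mono) fastforce
  also have "\<dots> = hdeg E S * k" by (simp add: hdeg_def)
  also have "\<dots> \<le> max_hdeg V E (card S) * k"
    using hdeg_le_max_hdeg[OF finite_vertices assms] by simp
  finally show ?thesis .
qed

lemma
  assumes "a \<in> pointed_edges E S"
  shows finite_petal: "finite (petal S a)"
    and card_petal: "card (petal S a) = k - 1 - card S"
proof -
  obtain e y where a: "a = (e, y)" and e: "e \<in> E" "S \<subseteq> e" "y \<in> e - S"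
    using assms by (auto simp: pointed_edges_def)
  have "finite S" using finite_edge[OF e(1)] e(2) finite_subset by blast
  then show "card (petal S a) = k - 1 - card S"
    using e card_edge[OF e(1)] by (simp add: a petal_def card_Diff_subset)
  show "finite (petal S a)" using finite_edge[OF e(1)] by (simp add: a petal_def)
qed

lemma finite_flowers: "finite (flowers E S p)"
  unfolding flowers_def by (rule finite_compatible_lists[OF finite_pointed_edges])

lemma card_flowers_le:
  assumes "S \<subseteq> V"
  shows "card (flowers E S p) \<le> (max_hdeg V E (card S) * k) ^ p"
proof -
  have "card (flowers E S p) \<le> card (pointed_edges E S) ^ p"
    unfolding flowers_def by (rule card_compatible_lists_le[OF finite_pointed_edges])
  also have "\<dots> \<le> (max_hdeg V E (card S) * k) ^ p"
    using card_pointed_edges_le[OF assms] by (rule power_mono) simp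
  finally show ?thesis .
qed

lemma
  assumes "finite S" "L \<in> flowers E S p"
  shows finite_flower_set: "finite (flower_set S L)"
    and card_flower_set: "card (flower_set S L) = card S + p * (k - 1 - card S)"
proof -
  have "finite (flower_set S L) \<and> card (flower_set S L) = card S + p * (k - 1 - card S)"
    using assms(2)
  proof (induction L arbitrary: p)
    case Nil
    then show ?case using assms(1) by (auto simp: flowers_def compatible_lists_def flower_set_def)
  next
    case (Cons a L)
    obtain n where p: "p = Suc n"
      using Cons.prems by (auto simp: flowers_def compatible_lists_def)
    then have a: "a \<in> pointed_edges E S" and disjoint: "\<forall>b\<in>set L. disjoint_petals S a b"
      and L: "L \<in> flowers E S n"
      using Cons.prems by (simp_all add: flowers_def Cons_in_compatible_lists_iff)
    have "flower_set S (a # L) = petal S a \<union> flower_set S L" by (auto simp: flower_set_def)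
    moreover have "petal S a \<inter> flower_set S L = {}"
      using disjoint by (auto simp: flower_set_def petal_def)
    ultimately show ?case
      using Cons.IH[OF L] finite_petal[OF a] card_petal[OF a] by (simp add: card_Un_disjoint p)
  qed
  then show "finite (flower_set S L)" "card (flower_set S L) = card S + p * (k - 1 - card S)"
    by auto
qed

lemma finite_threats: "finite (threats E M S)"
  using edge_subset by (intro finite_subset[OF _ finite_vertices]) (auto simp: threats_def)

lemma threats_empty_if_card_core:
  assumes "S \<subseteq> M" "card S = k"
  shows "threats E M S = {}"
proof -
  have "e = S" if "e \<in> E" "S \<subseteq> e" for e
    using card_subset_eq[OF finite_edge[OF that(1)] that(2)] assms(2) card_edge[OF that(1)] by simp
  then show ?thesis using assms(1) by (auto simp: threats_def)
qed

text \<open>A threat conflicts with another one only if they share some \<open>z\<close> outside \<open>S\<close>, and then both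
  pass through \<open>insert z S\<close>; this is what drives the induction.\<close>

lemma card_conflicting_threats_le:
  fixes N :: real
  assumes W: "W \<subseteq> threatening_edges E M S" "inj_on snd W" and b: "b \<in> W" and "0 \<le> N"
    and bound: "\<And>z. z \<in> M - S \<Longrightarrow> real (card (threats E M (insert z S))) \<le> N"
  shows "real (card {a \<in> W. \<not> disjoint_petals S a b}) \<le> real k * N"
proof -
  have b_pointed: "b \<in> pointed_edges E S" using W(1) b by (auto simp: threatening_edges_def)
  have finite_W: "finite W"
    using W(1)
    by (intro finite_subset[OF _ finite_pointed_edges]) (auto simp: threatening_edges_def)
  have through: "real (card {a \<in> W. z \<in> petal S a}) \<le> N" if z: "z \<in> petal S b" for z
  proof -
    have "card {a \<in> W. z \<in> petal S a} = card (snd ` {a \<in> W. z \<in> petal S a})"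
      using W(2) by (intro card_image[symmetric]) (auto intro: inj_on_subset)
    also have "\<dots> \<le> card (threats E M (insert z S))"
      using W(1) threat_through_petal by (intro card_mono finite_threats) fastforce
    finally show ?thesis
      using bound[of z] petal_threatening_edge_subset[of b E M S] W(1) b z by fastforce
  qed
  have "card {a \<in> W. \<not> disjoint_petals S a b} \<le> card (\<Union>z\<in>petal S b. {a \<in> W. z \<in> petal S a})"
    using finite_W finite_petal[OF b_pointed] by (intro card_mono) auto
  also have "\<dots> \<le> (\<Sum>z\<in>petal S b. card {a \<in> W. z \<in> petal S a})"
    using finite_petal[OF b_pointed] by (rule card_UN_le)
  finally have "real (card {a \<in> W. \<not> disjoint_petals S a b}) \<le>
      (\<Sum>z\<in>petal S b. real (card {a \<in> W. z \<in> petal S a}))"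
    unfolding of_nat_sum[symmetric] of_nat_le_iff .
  also have "\<dots> \<le> real (card (petal S b)) * N"
    using through by (rule sum_bounded_above)
  also have "\<dots> \<le> real k * N"
    using \<open>0 \<le> N\<close> by (intro mult_right_mono) (auto simp: card_petal[OF b_pointed])
  finally show ?thesis .
qed

lemma card_threats_le_of_few_occupied_flowers:
  fixes N g :: real
  assumes S: "S \<subseteq> M" and p: "0 < p" and g: "0 \<le> g" and N: "0 \<le> N"
    and bound: "\<And>z. z \<in> M - S \<Longrightarrow> real (card (threats E M (insert z S))) \<le> N"
    and few: "real (card (occupied_flowers E M S p)) \<le> g ^ p"
  shows "real (card (threats E M S)) \<le> real p * (real k * N) + g"
proof -
  obtain W where W: "W \<subseteq> threatening_edges E M S" "inj_on snd W" "threats E M S = snd ` W"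
    using subset_image_inj[of "threats E M S" snd "threatening_edges E M S"]
      threats_eq_image[OF S] by auto
  have "finite (snd ` W)" using finite_threats[of M S] W(3) by simp
  then have finite_W: "finite W" using W(2) by (rule finite_imageD)
  have "finite (occupied_flowers E M S p)" by (simp add: occupied_flowers_def finite_flowers)
  then have "card (compatible_lists (disjoint_petals S) W p) \<le> card (occupied_flowers E M S p)"
    using compatible_threatening_edges_subset_occupied_flowers[OF S W(1)] by (rule card_mono)
  then have "real (card (compatible_lists (disjoint_petals S) W p)) \<le> g ^ p" using few by linarith
  then have "real (card W) \<le> real p * (real k * N) + g"
    using card_conflicting_threats_le[OF W(1,2) _ N bound] N g p
    by (intro card_le_of_few_compatible_lists[OF finite_W]) auto
  then show ?thesis using W(2,3) by (simp add: card_image)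
qed

end

section \<open>The potential strategy for flowers\<close>

lemma sum_nonempty_subsets_le_1:
  assumes "finite V"
  shows "(\<Sum>S\<in>Pow V - {{}}. (1 / (2 * real (card V))) ^ card S) \<le> 1"
proof -
  let ?c = "1 / (2 * real (card V))"
  have "(\<Sum>S\<in>Pow V. ?c ^ card S) = (\<Prod>x\<in>V. ?c + 1)"
    using assms by (subst prod_add) simp_all
  also have "\<dots> = (1 + ?c) ^ card V" by (simp add: add.commute)
  also have "\<dots> \<le> exp ?c ^ card V" by (intro power_mono exp_ge_add_one_self) auto
  also have "\<dots> \<le> exp (1 / 2)" by (simp add: exp_of_nat_mult[symmetric])
  also have "\<dots> \<le> 2" by (rule exp_half_le2)
  finally show ?thesis using assms by (simp add: sum_diff1)
qed

lemma powr_divide_power: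
  fixes x :: real
  assumes "0 \<le> x" "0 < l" "0 < m"
  shows "(x powr (real l / real m)) ^ m = x ^ l"
proof (cases "x = 0")
  case False
  then show ?thesis using assms by (simp add: powr_realpow[symmetric] powr_powr)
qed (use assms in \<open>simp add: power_0_left\<close>)

lemma power_mult_ratio_power_le_1:
  fixes x r g :: real
  assumes "0 \<le> x" "0 \<le> r" "0 < g" "0 < l" "0 < p" "x powr (real l / real p) * r \<le> g"
  shows "x ^ l * (r / g) ^ p \<le> 1"
proof -
  have "x ^ l * (r / g) ^ p = (x powr (real l / real p) * r / g) ^ p"
    using powr_divide_power[of x l p] assms by (simp add: power_mult_distrib power_divide)
  also have "\<dots> \<le> 1" using assms by (intro power_le_one) (auto simp: divide_le_eq)
  finally show ?thesis .
qed

locale flower_bounds = finite_uniform_hypergraph V E k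
  for V :: "'a set" and E :: "'a set set" and k :: nat +
  fixes p :: "nat \<Rightarrow> nat" and g N :: "nat \<Rightarrow> real" and b :: nat
  assumes petals_pos: "l \<in> {1..<k} \<Longrightarrow> 0 < p l"
    and base_pos: "l \<in> {1..<k} \<Longrightarrow> 0 < g l"
    and bound_nonneg: "l \<in> {1..k} \<Longrightarrow> 0 \<le> N l"
    and recursion: "l \<in> {1..<k} \<Longrightarrow> real (p l) * (real k * N (Suc l)) + g l \<le> N l"
    and degree_bound: "l \<in> {1..<k} \<Longrightarrow>
      (2 * real (card V)) powr (real l / real (p l)) * (real (max_hdeg V E l) * real k)
        \<le> (1 + real b) ^ (k - 1 - l) * g l"
begin

definition cores :: "'a set set" where
  "cores = {S. S \<subseteq> V \<and> card S \<in> {1..<k}}"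

definition flower_family :: "('a set \<times> ('a set \<times> 'a) list) set" where
  "flower_family = (SIGMA S:cores. flowers E S (p (card S)))"

definition flower_weight :: "'a set \<times> ('a set \<times> 'a) list \<Rightarrow> real" where
  "flower_weight = (\<lambda>(S, L). 1 / g (card S) ^ p (card S))"

lemma finite_cores: "finite cores"
  using finite_vertices by (simp add: cores_def)

sublocale weighted_family flower_family "\<lambda>(S, L). flower_set S L" flower_weight b
proof
  show "finite flower_family"
    unfolding flower_family_def using finite_cores finite_flowers by (intro finite_SigmaI)
next
  fix i assume "i \<in> flower_family"
  then obtain S L where i: "i = (S, L)" "S \<in> cores" "L \<in> flowers E S (p (card S))"
    by (auto simp: flower_family_def)
  then have "finite S" "card S \<in> {1..<k}" using finite_vertex_subset by (auto simp: cores_def)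
  then show "finite (case i of (S, L) \<Rightarrow> flower_set S L)" "0 \<le> flower_weight i"
    using finite_flower_set[OF _ i(3)] base_pos by (auto simp: i(1) flower_weight_def less_imp_le)
qed

lemma core_flowers_bound:
  assumes "l \<in> {1..<k}"
  shows "(2 * real (card V)) ^ l *
    (real (max_hdeg V E l) * real k / ((1 + real b) ^ (k - 1 - l) * g l)) ^ p l \<le> 1"
  using assms petals_pos base_pos degree_bound by (intro power_mult_ratio_power_le_1) auto

lemma core_potential_le:
  assumes S: "S \<in> cores"
  shows "(\<Sum>L\<in>flowers E S (p (card S)). flower_weight (S, L) / (1 + real b) ^ card (flower_set S L))
    \<le> (1 / (2 * real (card V))) ^ card S / (1 + real b)"
proof -
  define l where "l = card S"
  have l: "l \<in> {1..<k}" and S_subset: "S \<subseteq> V" using S by (auto simp: l_def cores_def)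
  have "S \<noteq> {}" using l by (auto simp: l_def)
  then have card_V_pos: "0 < real (card V)"
    using S_subset finite_vertices by (auto simp: card_gt_0_iff)
  let ?\<beta> = "1 + real b" and ?D = "real (max_hdeg V E l) * real k" and ?s = "p l * (k - 1 - l)"
  have weight: "flower_weight (S, L) / ?\<beta> ^ card (flower_set S L)
      \<le> 1 / (g l ^ p l * (?\<beta> * ?\<beta> ^ ?s))"
    if L: "L \<in> flowers E S (p l)" for L
  proof -
    have "?\<beta> ^ Suc ?s \<le> ?\<beta> ^ (l + ?s)" using l by (intro power_increasing) auto
    then have "1 / (g l ^ p l * ?\<beta> ^ (l + ?s)) \<le> 1 / (g l ^ p l * ?\<beta> ^ Suc ?s)"
      using base_pos[OF l] by (intro divide_left_mono mult_left_mono) auto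
    then show ?thesis
      using card_flower_set[OF finite_vertex_subset[OF S_subset] L]
      by (simp add: flower_weight_def l_def)
  qed
  have "(\<Sum>L\<in>flowers E S (p l). flower_weight (S, L) / ?\<beta> ^ card (flower_set S L))
      \<le> real (card (flowers E S (p l))) * (1 / (g l ^ p l * (?\<beta> * ?\<beta> ^ ?s)))"
    using weight by (rule sum_bounded_above)
  also have "\<dots> \<le> ?D ^ p l * (1 / (g l ^ p l * (?\<beta> * ?\<beta> ^ ?s)))"
  proof (rule mult_right_mono)
    have "real (card (flowers E S (p l))) \<le> real ((max_hdeg V E l * k) ^ p l)"
      unfolding l_def by (intro of_nat_mono card_flowers_le[OF S_subset])
    then show "real (card (flowers E S (p l))) \<le> ?D ^ p l" by simp
  qed (use base_pos[OF l] in simp)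
  also have "\<dots> = (?D / (?\<beta> ^ (k - 1 - l) * g l)) ^ p l / ?\<beta>"
    by (simp add: power_divide power_mult_distrib power_mult[symmetric] mult.commute)
  also have "\<dots> \<le> (1 / (2 * real (card V))) ^ l / ?\<beta>"
    using core_flowers_bound[OF l] card_V_pos
    by (intro divide_right_mono) (auto simp: power_one_over pos_le_divide_eq mult.commute)
  finally show ?thesis by (simp add: l_def)
qed

lemma initial_potential_le: "potential {} {} \<le> 1 / (1 + real b)"
proof -
  let ?c = "1 / (2 * real (card V))"
  have "potential {} {} =
      (\<Sum>(S, L)\<in>flower_family. flower_weight (S, L) / (1 + real b) ^ card (flower_set S L))"
    unfolding potential_def by (intro sum.cong) auto
  also have "\<dots> = (\<Sum>S\<in>cores. \<Sum>L\<in>flowers E S (p (card S)).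
      flower_weight (S, L) / (1 + real b) ^ card (flower_set S L))"
    unfolding flower_family_def using finite_cores finite_flowers by (subst sum.Sigma) auto
  also have "\<dots> \<le> (\<Sum>S\<in>cores. ?c ^ card S / (1 + real b))"
    using core_potential_le by (rule sum_mono)
  also have "\<dots> = (\<Sum>S\<in>cores. ?c ^ card S) / (1 + real b)" by (simp only: sum_divide_distrib)
  also have "\<dots> \<le> (\<Sum>S\<in>Pow V - {{}}. ?c ^ card S) / (1 + real b)"
    using finite_vertices by (intro divide_right_mono sum_mono2) (auto simp: cores_def)
  also have "\<dots> \<le> 1 / (1 + real b)"
    using sum_nonempty_subsets_le_1[OF finite_vertices] by (intro divide_right_mono) auto
  finally show ?thesis .
qed

lemma few_occupied_flowers:
  assumes "M \<subseteq> V" and weight: "occupied_weight M \<le> 1" and S: "S \<subseteq> M" "card S \<in> {1..<k}"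
  shows "real (card (occupied_flowers E M S (p (card S)))) \<le> g (card S) ^ p (card S)"
proof -
  let ?occ = "occupied_flowers E M S (p (card S))"
  have "real (card ?occ) / g (card S) ^ p (card S) = (\<Sum>i\<in>Pair S ` ?occ. flower_weight i)"
    by (subst sum.reindex) (auto simp: inj_on_def flower_weight_def)
  also have "\<dots> \<le> occupied_weight M"
    unfolding occupied_weight_def using finite_index weight_nonneg S assms(1)
    by (intro sum_mono2) (auto simp: flower_family_def cores_def occupied_flowers_def)
  also have "\<dots> \<le> 1" by (rule weight)
  finally show ?thesis using base_pos[OF S(2)] by (simp add: pos_divide_le_eq)
qed

lemma card_threats_le_bound:
  assumes M: "M \<subseteq> V"
    and few: "\<And>S. S \<subseteq> M \<Longrightarrow> card S \<in> {1..<k} \<Longrightarrow>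
      real (card (occupied_flowers E M S (p (card S)))) \<le> g (card S) ^ p (card S)"
    and S: "S \<subseteq> M" "card S \<in> {1..k}"
  shows "real (card (threats E M S)) \<le> N (card S)"
  using S
proof (induction "k - card S" arbitrary: S)
  case 0
  then have "threats E M S = {}" by (intro threats_empty_if_card_core) auto
  then show ?case using bound_nonneg[OF "0.prems"(2)] by simp
next
  case (Suc d)
  define l where "l = card S"
  have l: "l \<in> {1..<k}" using Suc.hyps(2) Suc.prems(2) by (auto simp: l_def)
  have "finite S" using Suc.prems(1) M finite_vertex_subset by blast
  have through: "real (card (threats E M (insert z S))) \<le> N (Suc l)" if z: "z \<in> M - S" for z
  proof -
    have "card (insert z S) = Suc l" using z \<open>finite S\<close> by (simp add: l_def)
    then show ?thesis
      using Suc.hyps(1)[of "insert z S"] Suc.hyps(2) Suc.prems(1) z l by (auto simp: l_def)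
  qed
  have "real (card (threats E M S)) \<le> real (p l) * (real k * N (Suc l)) + g l"
    using Suc.prems(1) petals_pos[OF l] less_imp_le[OF base_pos[OF l]] bound_nonneg[of "Suc l"] l
      through few[OF Suc.prems(1)]
    by (intro card_threats_le_of_few_occupied_flowers) (auto simp: l_def)
  also have "\<dots> \<le> N l" by (rule recursion[OF l])
  finally show ?case by (simp add: l_def)
qed

lemma breaker_wins_by_flowers:
  assumes k: "2 \<le> k" and q: "N 1 + real b \<le> real q"
  shows "breaker_wins V E q"
proof (rule breaker_wins_by_potential[OF finite_vertices _ _ initial_potential_le])
  show "\<Union> E \<subseteq> V" using edge_subset by blast
  show "2 \<le> card e" if "e \<in> E" for e using card_edge[OF that] k by simp
next
  fix M x assume "M \<subseteq> V" "x \<in> M" "occupied_weight M \<le> 1"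
  then have "real (card (threats E M {x})) \<le> N (card {x})"
    using k by (intro card_threats_le_bound few_occupied_flowers) auto
  then show "card (threats E M {x}) + b \<le> q" using q by simp
qed

end

section \<open>Choice of the parameters\<close>

lemma le_power_if_powr_inverse_le:
  fixes x :: real
  assumes "0 \<le> x" "0 < m" "x powr (1 / real m) \<le> y"
  shows "x \<le> y ^ m"
  using powr_divide_power[of x 1 m] power_mono[OF assms(3), of m] assms by simp

lemma less_powr_inverse_if_power_less:
  fixes x :: real
  assumes "0 < m" "0 \<le> y" "x ^ m < y"
  shows "x < y powr (1 / real m)"
  using powr_divide_power[of y 1 m] assms
  by (intro power_less_imp_less_base[of x m]) auto

lemma nat_ceiling_bounds:
  fixes x :: real
  assumes "1 \<le> x"
  shows "x \<le> real (nat \<lceil>x\<rceil>)" "real (nat \<lceil>x\<rceil>) \<le> 2 * x"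
  using assms by linarith+

lemma powr_of_nat_mono: "a \<le> b \<Longrightarrow> real n powr a \<le> real n powr b"
  by (cases "n = 0") (auto intro: powr_mono)

text \<open>Subtracting 1 absorbs the inhomogeneous term \<open>c\<close>, at the price of \<open>2 \<le> a\<close>.\<close>

lemma geometric_recursion:
  fixes a c :: real
  assumes "2 \<le> a" "0 \<le> c" "l < k"
  shows "a * (c * (a ^ (k - Suc l) - 1)) + c \<le> c * (a ^ (k - l) - 1)"
proof -
  have "a ^ (k - l) = a * a ^ (k - Suc l)" using assms(3) by (metis Suc_diff_Suc power_Suc)
  then have "c * (a ^ (k - l) - 1) - (a * (c * (a ^ (k - Suc l) - 1)) + c) = c * (a - 2)"
    by (simp add: algebra_simps)
  moreover have "0 \<le> c * (a - 2)" using assms by simp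
  ultimately show ?thesis by linarith
qed

lemma power_petals_edge_size_le:
  fixes t :: real
  assumes "0 < k" "0 < p" "real p \<le> t powr (1 / real k)" "real k ^ k \<le> t"
  shows "real (p * k) ^ (k - 2) \<le> t\<^sup>2"
proof -
  have t: "0 \<le> t" using assms(4) zero_le_power[of "real k" k] by linarith
  have "real (p * k) ^ (k - 2) \<le> real (p * k) ^ k"
    using assms(1,2) by (intro power_increasing) (auto simp: Suc_le_eq simp flip: of_nat_mult)
  also have "\<dots> \<le> (t powr (1 / real k) * real k) ^ k"
    using assms(3) by (auto intro!: power_mono mult_right_mono)
  also have "\<dots> = t * real k ^ k"
    using powr_divide_power[OF t, of 1 k] assms(1) by (simp add: power_mult_distrib)
  also have "\<dots> \<le> t\<^sup>2" using assms(4) t by (simp add: power2_eq_square mult_left_mono)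
  finally show ?thesis .
qed

lemma power_le_mult_power:
  fixes x y :: real
  assumes "0 \<le> x" "x \<le> y" "0 < m"
  shows "x ^ m \<le> y ^ (m - 1) * x"
  using assms by (subst power_minus_mult[symmetric]) (auto intro!: mult_right_mono power_mono)

definition degree_factor :: "nat \<Rightarrow> real \<Rightarrow> real \<Rightarrow> real" where
  "degree_factor k t v =
    ((t * real k) powr (t * real k) * real k powr t * v\<^sup>2) powr (real k / t powr (1 / real k))"

lemma powr_le_degree_factor:
  assumes k: "0 < k" "l \<le> k" and t: "4 \<le> t" and p: "t powr (1 / real k) / 2 \<le> real p"
  shows "(2 * real n) powr (real l / real p) \<le> degree_factor k t (real n)"
proof -
  let ?\<tau> = "t powr (1 / real k)"
  have \<tau>: "0 < ?\<tau>" using t by simp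
  have "real l / real p \<le> real k / (?\<tau> / 2)" using k p \<tau> by (intro frac_le) auto
  then have "real (2 * n) powr (real l / real p) \<le> real (2 * n) powr (2 * (real k / ?\<tau>))"
    by (intro powr_of_nat_mono) (simp add: mult.commute)
  also have "\<dots> = ((2 * real n) powr 2) powr (real k / ?\<tau>)"
    by (simp only: powr_powr of_nat_mult of_nat_numeral)
  also have "\<dots> = (4 * (real n)\<^sup>2) powr (real k / ?\<tau>)" by (simp add: power_mult_distrib)
  also have "\<dots> \<le> degree_factor k t (real n)"
    unfolding degree_factor_def
  proof (intro powr_mono2 mult_right_mono)
    have "4 * 1 \<le> t * real k" using t k by (intro mult_mono) auto
    then have "4 powr 1 \<le> (t * real k) powr (t * real k)" by (intro powr_mono_both) auto
    moreover have "1 \<le> real k powr t" using k t by (intro ge_one_powr_ge_zero) auto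
    ultimately have "4 * 1 \<le> (t * real k) powr (t * real k) * real k powr t"
      by (intro mult_mono) auto
    then show "4 \<le> (t * real k) powr (t * real k) * real k powr t" by simp
  qed (use \<tau> in auto)
  finally show ?thesis by simp
qed

locale two_petal_counts = finite_uniform_hypergraph V E k
  for V :: "'a set" and E :: "'a set set" and k :: nat +
  fixes p\<^sub>1 p q :: nat and Q :: real
  assumes edge_size: "2 \<le> k" and counts_pos: "0 < p\<^sub>1" "0 < p" and Q_pos: "0 < Q"
    and bias: "real p\<^sub>1 * (real k)\<^sup>2 * real (p * k) ^ (k - 2) * Q \<le> real q / 4"
    and degree_1: "(2 * real (card V)) powr (1 / real p\<^sub>1) * (real (max_hdeg V E 1) * real k)
      \<le> (real q / 4) ^ (k - 1)"
    and degree: "l \<in> {2..<k} \<Longrightarrow>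
      (2 * real (card V)) powr (real l / real p) * real (max_hdeg V E l) \<le> Q ^ (k - l)"
begin

definition petals :: "nat \<Rightarrow> nat" where
  "petals l = (if l = 1 then p\<^sub>1 else p)"

definition base :: "nat \<Rightarrow> real" where
  "base l = (if l = 1 then real q / 4 else real k * Q)"

definition bound :: "nat \<Rightarrow> real" where
  "bound l = (if l = 1 then real q / 2 else real k * Q * (real (p * k) ^ (k - l) - 1))"

lemma two_le_petals_edge_size: "2 \<le> real (p * k)"
proof -
  have "1 * 2 \<le> p * k" using counts_pos edge_size by (intro mult_mono) auto
  then show ?thesis by (simp flip: of_nat_mult)
qed

lemma Q_le: "Q \<le> real q / 4"
proof -
  have "1 * 1 * 1 \<le> real p\<^sub>1 * (real k)\<^sup>2 * real (p * k) ^ (k - 2)"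
    using counts_pos edge_size two_le_petals_edge_size by (intro mult_mono one_le_power) auto
  then have "1 * Q \<le> real p\<^sub>1 * (real k)\<^sup>2 * real (p * k) ^ (k - 2) * Q"
    using Q_pos by (intro mult_right_mono) auto
  then show ?thesis using bias by linarith
qed

lemma bound_recursion:
  assumes "l \<in> {1..<k}"
  shows "real (petals l) * (real k * bound (Suc l)) + base l \<le> bound l"
proof (cases "l = 1")
  case True
  have "real p\<^sub>1 * (real k * (real k * Q * (real (p * k) ^ (k - 2) - 1))) \<le>
      real p\<^sub>1 * (real k * (real k * Q * real (p * k) ^ (k - 2)))"
    using Q_pos by (intro mult_left_mono) auto
  also have "\<dots> \<le> real q / 4" using bias by (simp add: power2_eq_square mult_ac)
  finally show ?thesis using True by (simp add: bound_def base_def petals_def numeral_2_eq_2)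
next
  case False
  then show ?thesis
    using geometric_recursion[of "real (p * k)" "real k * Q" l k]
      two_le_petals_edge_size Q_pos assms
    by (simp add: bound_def base_def petals_def mult_ac)
qed

lemma max_hdeg_bound:
  assumes "l \<in> {1..<k}"
  shows "(2 * real (card V)) powr (real l / real (petals l)) * (real (max_hdeg V E l) * real k)
    \<le> (1 + real (q div 2)) ^ (k - 1 - l) * base l"
proof -
  have q: "real q / 4 \<le> 1 + real (q div 2)" by auto
  show ?thesis
  proof (cases "l = 1")
    case True
    have "(real q / 4) ^ (k - 1) \<le> (1 + real (q div 2)) ^ (k - 1 - 1) * (real q / 4)"
      using q edge_size by (intro power_le_mult_power) auto
    then show ?thesis using degree_1 True by (simp add: base_def petals_def)
  next
    case False
    have "(2 * real (card V)) powr (real l / real p) * real (max_hdeg V E l) \<le> Q ^ (k - l)"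
      using degree[of l] False assms by simp
    also have "\<dots> \<le> (1 + real (q div 2)) ^ (k - l - 1) * Q"
      using Q_pos Q_le q assms by (intro power_le_mult_power) auto
    finally have "(2 * real (card V)) powr (real l / real p) * real (max_hdeg V E l) * real k
        \<le> (1 + real (q div 2)) ^ (k - l - 1) * Q * real k"
      by (rule mult_right_mono) simp
    then show ?thesis using False by (simp add: base_def petals_def mult_ac diff_right_commute)
  qed
qed

sublocale flower_bounds V E k petals base bound "q div 2"
proof
  show "0 < petals l" "0 < base l" "0 \<le> bound l" for l
    using counts_pos edge_size Q_pos Q_le two_le_petals_edge_size
    by (auto simp: petals_def base_def bound_def)
qed (fact bound_recursion max_hdeg_bound)+

lemma breaker_wins: "breaker_wins V E q"
  using edge_size by (intro breaker_wins_by_flowers) (auto simp: bound_def)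

end

lemma petal_counts_exist:
  fixes t :: real
  assumes k: "2 \<le> k" and t: "(2 * real k) ^ k < t"
  obtains p\<^sub>1 p :: nat where "0 < p\<^sub>1" "t \<le> real p\<^sub>1" "real p\<^sub>1 \<le> 2 * t"
    and "0 < p" "t powr (1 / real k) / 2 \<le> real p" "real (p * k) ^ (k - 2) \<le> t\<^sup>2"
proof
  let ?\<tau> = "t powr (1 / real k)" and ?p = "nat \<lceil>t powr (1 / real k) / 2\<rceil>"
  have power_k_le: "real k ^ k \<le> t" using t power_mono[of "real k" "2 * real k" k] by simp
  have t_ge_1: "1 \<le> t" using one_le_power[of "real k" k] k power_k_le by linarith
  then show "t \<le> real (nat \<lceil>t\<rceil>)" "real (nat \<lceil>t\<rceil>) \<le> 2 * t" "0 < nat \<lceil>t\<rceil>"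
    using nat_ceiling_bounds[of t] by auto
  have "2 * real k < ?\<tau>" using k t t_ge_1 by (intro less_powr_inverse_if_power_less) auto
  then have "1 \<le> ?\<tau> / 2" using k by simp
  then have p: "?\<tau> / 2 \<le> real ?p" "real ?p \<le> ?\<tau>" "0 < ?p"
    using nat_ceiling_bounds[of "?\<tau> / 2"] by auto
  then show "?\<tau> / 2 \<le> real ?p" "0 < ?p" by auto
  show "real (?p * k) ^ (k - 2) \<le> t\<^sup>2"
    using k p power_k_le by (intro power_petals_edge_size_le) auto
qed

lemma (in finite_uniform_hypergraph) breaker_wins_if_degrees_small:
  fixes t Q :: real
  assumes k: "2 \<le> k" and t: "(2 * real k) ^ k < t"
    and Q: "0 < Q" and bias: "8 * (real k)\<^sup>2 * t ^ 3 * Q \<le> real q"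
    and degree_1: "((2 * real (card V)) powr (1 / t) * real (max_hdeg V E 1) * real k)
      powr (1 / (real k - 1)) \<le> real q / 4"
    and degree: "\<And>l. l \<in> {2..<k} \<Longrightarrow>
      (real (max_hdeg V E l) * degree_factor k t (real (card V))) powr (1 / (real k - real l)) \<le> Q"
  shows "breaker_wins V E q"
proof -
  let ?v = "real (card V)"
  have "(2 * real k) ^ 1 \<le> (2 * real k) ^ k" using k by (intro power_increasing) auto
  then have t_ge_4: "4 \<le> t" using t k by simp
  obtain p\<^sub>1 p where p\<^sub>1: "0 < p\<^sub>1" "t \<le> real p\<^sub>1" "real p\<^sub>1 \<le> 2 * t"
    and p: "0 < p" "t powr (1 / real k) / 2 \<le> real p" "real (p * k) ^ (k - 2) \<le> t\<^sup>2"
    using petal_counts_exist[OF k t] .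
  interpret two_petal_counts V E k p\<^sub>1 p q Q
  proof
    have "real p\<^sub>1 * (real k)\<^sup>2 * real (p * k) ^ (k - 2) * Q \<le> 2 * t * (real k)\<^sup>2 * t\<^sup>2 * Q"
      using p\<^sub>1 p(3) t_ge_4 Q by (intro mult_mono) auto
    also have "\<dots> \<le> real q / 4" using bias by (simp add: power2_eq_square power3_eq_cube mult_ac)
    finally show "real p\<^sub>1 * (real k)\<^sup>2 * real (p * k) ^ (k - 2) * Q \<le> real q / 4" .
    have "real (2 * card V) powr (1 / real p\<^sub>1) \<le> real (2 * card V) powr (1 / t)"
      using p\<^sub>1 t_ge_4 by (intro powr_of_nat_mono divide_left_mono) auto
    then have "(2 * ?v) powr (1 / real p\<^sub>1) * (real (max_hdeg V E 1) * real k)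
        \<le> (2 * ?v) powr (1 / t) * real (max_hdeg V E 1) * real k"
      by (simp add: mult.assoc mult_right_mono)
    also have "\<dots> \<le> (real q / 4) ^ (k - 1)"
      using degree_1 k by (intro le_power_if_powr_inverse_le) (auto simp: of_nat_diff)
    finally show "(2 * ?v) powr (1 / real p\<^sub>1) * (real (max_hdeg V E 1) * real k)
        \<le> (real q / 4) ^ (k - 1)" .
    fix l assume l: "l \<in> {2..<k}"
    have "(2 * ?v) powr (real l / real p) * real (max_hdeg V E l)
        \<le> degree_factor k t ?v * real (max_hdeg V E l)"
      using l t_ge_4 p by (intro mult_right_mono powr_le_degree_factor) auto
    also have "\<dots> \<le> Q ^ (k - l)"
      using degree[OF l] l
      by (intro le_power_if_powr_inverse_le) (auto simp: of_nat_diff degree_factor_def mult.commute)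
    finally show "(2 * ?v) powr (real l / real p) * real (max_hdeg V E l) \<le> Q ^ (k - l)" .
  qed (use k Q p\<^sub>1 p in auto)
  show ?thesis by (rule breaker_wins)
qed

theorem theorem3p1:
  fixes V :: "'a set" and E :: "'a set set" and k q :: nat and t :: real
  assumes "k \<ge> 2"
    and "t > (2 * real k) ^ k"
    and "uniform_hypergraph V E k"
    and "real q > 4 * max
      (((2 * real (card V)) powr (1 / t) * real (max_hdeg V E 1) * real k * exp 1)
          powr (1 / (real k - 1)))
      (2 * (real k)\<^sup>2 * t ^ 3 *
        (Max (insert 0 ((\<lambda>l. (real (max_hdeg V E l) *
              ((t * real k) powr (t * real k) * real k powr t * (real (card V))\<^sup>2)
                powr (real k / t powr (1 / real k)))
            powr (1 / (real k - real l))) ` {2..k - 1})) + 2))"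
  shows "breaker_wins V E q"
proof -
  interpret finite_uniform_hypergraph V E k by unfold_locales (rule assms(3))
  define first_term where "first_term =
    (2 * real (card V)) powr (1 / t) * real (max_hdeg V E 1) * real k"
  define root_term where "root_term =
    (\<lambda>l. (real (max_hdeg V E l) * degree_factor k t (real (card V))) powr (1 / (real k - real l)))"
  define max_root where "max_root = Max (insert 0 (root_term ` {2..k - 1}))"
  have q: "4 * max ((first_term * exp 1) powr (1 / (real k - 1)))
      (2 * (real k)\<^sup>2 * t ^ 3 * (max_root + 2)) < real q"
    using assms(4) by (simp only: first_term_def root_term_def max_root_def degree_factor_def)
  have max_root_nonneg: "0 \<le> max_root" unfolding max_root_def by (intro Max_ge) auto
  have "root_term l \<le> max_root" if "l \<in> {2..<k}" for l
    unfolding max_root_def using that by (intro Max_ge) auto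
  then have root_term: "root_term l \<le> max_root + 2" if "l \<in> {2..<k}" for l using that by fastforce
  have "first_term powr (1 / (real k - 1)) \<le> (first_term * exp 1) powr (1 / (real k - 1))"
    using assms(1) mult_left_mono[of 1 "exp 1" first_term]
    by (intro powr_mono2) (auto simp: first_term_def)
  also have "\<dots> \<le> real q / 4" using q by simp
  finally have first_term: "first_term powr (1 / (real k - 1)) \<le> real q / 4" .
  show ?thesis
    by (rule breaker_wins_if_degrees_small[OF assms(1,2) _ _
          first_term[unfolded first_term_def] root_term[unfolded root_term_def]])
      (use max_root_nonneg q in auto)
qed

end
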